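(* For every $m\in\mathbb{Z}_{+}=\mathbb{N}\cup\{0\}$, $$E_m=2\,m!\sum_{n=-\infty}^{\infty}\frac{1}{\left((2n+1)\pi i\right)^{m+1}}.$$
   Context: The Euler numbers $E_n$, $n\ge 0$, are defined by the Taylor series expansion (about $t=0$) $$\frac{2}{e^t+1}=\sum_{n=0}^{\infty}E_n\frac{t^n}{n!},$$ so that $E_0=1$, $E_1=-\tfrac12$, $E_2=0$, $E_3=\tfrac14$, and so on. Here $i=\sqrt{-1}$.
   Formalization: The case m = 0 is excluded, since the formula fails there: E_0 = 1, but every term 1/((2n+1)πi) is purely imaginary, so the series cannot sum to 1/2; the identity is stated for all m ≥ 1, with the series converging absolutely. *)

theory Defs
  imports "HOL-Complex_Analysis.Complex_Analysis"
begin

definition euler_gf :: "complex \<Rightarrow> complex" where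
  "euler_gf t = 2 / (exp t + 1)"

text \<open>
  These are the numbers generated by $2/(e^t+1)$, complex-valued here, not those generated by
  the reciprocal of the hyperbolic cosine.
\<close>

definition euler_num :: "nat \<Rightarrow> complex" where
  "euler_num n = fact n * fps_nth (fps_expansion euler_gf 0) n"

lemma euler_gf_has_fps_expansion:
  "euler_gf has_fps_expansion Abs_fps (\<lambda>n. euler_num n / fact n)"
proof -
  have "euler_gf analytic_on {0}"
    unfolding euler_gf_def by (intro analytic_intros) auto
  then have "euler_gf has_fps_expansion fps_expansion euler_gf 0"
    by (rule analytic_at_imp_has_fps_expansion_0)
  also have "fps_expansion euler_gf 0 = Abs_fps (\<lambda>n. euler_num n / fact n)"
    by (rule fps_ext) (simp add: euler_num_def)
  finally show ?thesis .
qed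

lemma euler_num_0: "euler_num 0 = 1"
  by (simp add: euler_num_def fps_expansion_def euler_gf_def)

lemma euler_num_1: "euler_num 1 = -1/2"
proof -
  have "(euler_gf has_field_derivative (-1/2)) (at 0)"
    unfolding euler_gf_def by (auto intro!: derivative_eq_intros)
  then show ?thesis
    by (simp add: euler_num_def fps_expansion_def DERIV_imp_deriv)
qed

text \<open>
  For \<^term>\<open>m = 0\<close> all terms of the bilateral series are purely imaginary. Since
  \<^term>\<open>euler_num 0 = 1\<close>, no limit of finite partial sums, in whatever order they are taken,
  can give the right value (the symmetric partial sums tend to $0$). The series representation
  of \<^term>\<open>euler_num m\<close> therefore has to be restricted to positive \<^term>\<open>m\<close>.
\<close>

lemma euler_num_0_not_bilateral_series:
  fixes S :: "'k \<Rightarrow> int set"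
  assumes "F \<noteq> bot"
  shows "\<not> ((\<lambda>k. 2 * fact 0 * (\<Sum>n\<in>S k. 1 / ((2 * of_int n + 1) * of_real pi * \<i>) ^ (0 + 1)))
              \<longlongrightarrow> euler_num 0) F"
proof
  assume "((\<lambda>k. 2 * fact 0 * (\<Sum>n\<in>S k. 1 / ((2 * of_int n + 1) * of_real pi * \<i>) ^ (0 + 1)))
              \<longlongrightarrow> euler_num 0) F"
  from tendsto_Re[OF this] have "((\<lambda>k. 0) \<longlongrightarrow> (1::real)) F"
    by (simp add: euler_num_0 Re_divide)
  with assms show False
    using tendsto_unique[OF assms tendsto_const] by fastforce
qed

end

theory Submission
  imports Defs
begin

text \<open>
  Write $t = 2\pi i w$ and $\psi$ for the digamma function. Then
  $2/(e^t+1) = 1 - i\tan(\pi w) = 1 + i\cot(\pi(1/2+w))$, and the cotangent is a difference of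
  digamma values by the reflection formula, so that
  \[ \frac{2}{e^t+1} = 1 + \frac{i}{\pi}\bigl(\psi(1/2-w) - \psi(1/2+w)\bigr). \]
  This plays the part of the partial fraction expansion of the generating function: $\psi(1/2+w)$
  carries the poles in one half plane and $\psi(1/2-w)$ those in the other.

  For $m \ge 1$ the $m$-th Taylor coefficient at $0$ of the right-hand side is a multiple of the
  polygamma value $\psi^{(m)}(1/2)$, itself a multiple of the absolutely convergent sum of the
  powers $(k+1/2)^{-(m+1)}$ with $k \ge 0$. Up to a factor those are the terms of the bilateral
  series with index $n = k$, while the index $n = -1-k$ reproduces them with the sign
  $(-1)^{m+1}$; the same sign comes from the reflection $w \mapsto -w$.
  The argument thus rests on \<open>euler_gf_eq_Digamma\<close>, \<open>higher_deriv_euler_gf\<close> and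
  \<open>has_sum_half_integer_powers\<close>.
\<close>

text \<open>
  This is the logarithmic derivative of Euler's reflection formula
  $\Gamma(z)\Gamma(1-z) = \pi/\sin(\pi z)$.
\<close>

lemma Digamma_reflection:
  fixes z :: complex
  assumes "z \<notin> \<int>"
  shows "Digamma (1 - z) - Digamma z = of_real pi * cot (of_real pi * z)"
proof -
  have z: "z \<notin> \<int>\<^sub>\<le>\<^sub>0" "1 - z \<notin> \<int>\<^sub>\<le>\<^sub>0"
    using assms nonpos_Ints_subset_Ints Ints_diff[OF Ints_1, of "1 - z"] by auto
  have sin: "sin (of_real pi * z) \<noteq> 0"
    using assms by (auto simp: sin_eq_0)
  have "((\<lambda>w. Gamma w * Gamma (1 - w)) has_field_derivative
          Gamma z * Gamma (1 - z) * (Digamma z - Digamma (1 - z))) (at z)"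
    using z by (auto intro!: derivative_eq_intros simp: algebra_simps)
  moreover have "((\<lambda>w. of_real pi / sin (of_real pi * w)) has_field_derivative
          - of_real pi * (of_real pi * cos (of_real pi * z)) / sin (of_real pi * z) ^ 2) (at z)"
    using sin by (auto intro!: derivative_eq_intros simp: power2_eq_square)
  ultimately have "of_real pi / sin (of_real pi * z) * (Digamma z - Digamma (1 - z)) =
      - of_real pi * (of_real pi * cos (of_real pi * z)) / sin (of_real pi * z) ^ 2"
    unfolding Gamma_reflection_complex by (rule DERIV_unique)
  also have "\<dots> = of_real pi / sin (of_real pi * z) * (- (of_real pi * cot (of_real pi * z)))"
    by (simp add: cot_def power2_eq_square)
  finally have "Digamma z - Digamma (1 - z) = - (of_real pi * cot (of_real pi * z))"
    using sin by (subst (asm) mult_left_cancel) auto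
  thus ?thesis
    by (metis minus_diff_eq minus_minus)
qed

text \<open>
  The digamma function and the cotangent at $1/2 + w$ are holomorphic as long as $w$ stays in the
  open strip of width one around the imaginary axis.
\<close>

lemma half_plus_strip_notin_Ints:
  fixes w :: complex
  assumes "\<bar>Re w\<bar> < 1/2"
  shows "1/2 + w \<notin> \<int>" "1/2 + w \<notin> \<int>\<^sub>\<le>\<^sub>0"
proof -
  show "1/2 + w \<notin> \<int>"
  proof
    assume "1/2 + w \<in> \<int>"
    then obtain k where "1/2 + w = of_int k" by (elim Ints_cases)
    from arg_cong[OF this, of Re] have "(0::real) < of_int k" "of_int k < (1::real)"
      using assms by auto
    thus False by simp
  qed
  thus "1/2 + w \<notin> \<int>\<^sub>\<le>\<^sub>0" using nonpos_Ints_subset_Ints by blast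
qed

lemma euler_gf_eq_Digamma:
  fixes w :: complex
  assumes "\<bar>Re w\<bar> < 1/2"
  shows "euler_gf (2 * of_real pi * \<i> * w) =
           1 + \<i> / of_real pi * (Digamma (1/2 - w) - Digamma (1/2 + w))"
proof -
  define x where "x = of_real pi * w"
  have "cos x \<noteq> 0"
  proof
    assume "cos x = 0"
    hence "sin (of_real pi * (1/2 + w)) = 0"
      by (simp add: x_def sin_add ring_distribs flip: sin_of_real cos_of_real)
    with half_plus_strip_notin_Ints[OF assms] show False
      by (auto simp: sin_eq_0)
  qed
  have e: "exp (\<i> * x) = cos x + \<i> * sin x" "exp (-(\<i> * x)) = cos x - \<i> * sin x"
    using exp_Euler[of x] exp_Euler[of "-x"] by auto
  have "exp (2 * of_real pi * \<i> * w) + 1 = exp (\<i> * x) * (exp (\<i> * x) + exp (-(\<i> * x)))"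
    by (simp add: ring_distribs x_def flip: exp_add) (simp add: algebra_simps)
  also have "\<dots> = exp (\<i> * x) * (2 * cos x)" by (simp add: e)
  finally have "euler_gf (2 * of_real pi * \<i> * w) = exp (-(\<i> * x)) / cos x"
    using \<open>cos x \<noteq> 0\<close> by (simp add: euler_gf_def exp_minus field_simps)
  also have "\<dots> = 1 - \<i> * tan x"
    using \<open>cos x \<noteq> 0\<close> by (simp add: e tan_def field_simps)
  also have "- tan x = cot (of_real pi * (1/2 + w))"
    by (simp add: x_def sin_add cos_add ring_distribs tan_def cot_def flip: sin_of_real cos_of_real)
  hence "1 - \<i> * tan x = 1 + \<i> * cot (of_real pi * (1/2 + w))"
    by (metis diff_conv_add_uminus mult_minus_right)
  also have "\<dots> = 1 + \<i> / of_real pi * (Digamma (1 - (1/2 + w)) - Digamma (1/2 + w))"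
    unfolding Digamma_reflection[OF half_plus_strip_notin_Ints(1)[OF assms]] by simp
  also have "1 - (1/2 + w) = 1/2 - w" by simp
  finally show ?thesis .
qed

text \<open>
  The identity is differentiated on the whole strip $|\mathrm{Im}\,t| < \pi$ between the two poles
  nearest to $0$, not just at $0$: each further derivative at a point needs the previous one in a
  neighbourhood of it. Only the constant $1$ singles out the case $m = 0$.
\<close>

lemma higher_deriv_euler_gf:
  assumes "\<bar>Im t\<bar> < pi"
  defines "w \<equiv> \<lambda>t. t / (2 * of_real pi * \<i>)"
  shows "(deriv ^^ m) euler_gf t = (if m = 0 then 1 else 0) + \<i> / of_real pi *
           ((-1) ^ m * Polygamma m (1/2 - w t) - Polygamma m (1/2 + w t)) / (2 * of_real pi * \<i>) ^ m"
  using assms(1)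
proof (induction m arbitrary: t)
  case 0
  hence "\<bar>Re (w t)\<bar> < 1/2" by (simp add: w_def Re_divide power2_eq_square)
  from euler_gf_eq_Digamma[OF this] show ?case by (simp add: w_def)
next
  case (Suc m)
  let ?g = "\<lambda>t. (if m = 0 then 1 else 0) + \<i> / of_real pi *
           ((-1) ^ m * Polygamma m (1/2 - w t) - Polygamma m (1/2 + w t)) / (2 * of_real pi * \<i>) ^ m"
  have re: "\<bar>Re (w t)\<bar> < 1/2"
    using Suc.prems by (simp add: w_def Re_divide power2_eq_square)
  have *: "1/2 + w t \<notin> \<int>\<^sub>\<le>\<^sub>0" "1/2 - w t \<notin> \<int>\<^sub>\<le>\<^sub>0"
    using half_plus_strip_notin_Ints(2)[of "w t"] half_plus_strip_notin_Ints(2)[of "- w t"] re by auto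
  have "open {t. \<bar>Im t\<bar> < pi}"
    by (intro open_Collect_less continuous_intros)
  hence "eventually (\<lambda>t. (deriv ^^ m) euler_gf t = ?g t) (nhds t)"
    using Suc by (auto simp: eventually_nhds)
  hence "(deriv ^^ Suc m) euler_gf t = deriv ?g t"
    by (simp add: deriv_cong_ev)
  also have "\<dots> = \<i> / of_real pi *
      ((-1) ^ Suc m * Polygamma (Suc m) (1/2 - w t) - Polygamma (Suc m) (1/2 + w t))
        / (2 * of_real pi * \<i>) ^ Suc m"
    using * unfolding w_def
    by (intro DERIV_imp_deriv) (auto intro!: derivative_eq_intros simp: field_simps)
  finally show ?case by simp
qed

lemma euler_num_eq_Polygamma:
  assumes "m \<ge> 1"
  shows "euler_num m =
    \<i> / of_real pi * ((-1) ^ m - 1) * Polygamma m (1/2) / (2 * of_real pi * \<i>) ^ m"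
proof -
  have "euler_num m = (deriv ^^ m) euler_gf 0"
    by (simp add: euler_num_def fps_expansion_def)
  also have "\<dots> = \<i> / of_real pi * ((-1) ^ m - 1) * Polygamma m (1/2) / (2 * of_real pi * \<i>) ^ m"
    using higher_deriv_euler_gf[of 0 m] assms by (simp add: algebra_simps diff_divide_distrib)
  finally show ?thesis .
qed


lemma has_sum_int_split:
  fixes f :: "int \<Rightarrow> 'a :: topological_comm_monoid_add"
  assumes "((\<lambda>k. f (int k)) has_sum a) UNIV" "((\<lambda>k. f (- 1 - int k)) has_sum b) UNIV"
  shows "(f has_sum (a + b)) UNIV"
proof -
  have "bij_betw int UNIV {0..}"
    by (rule bij_betwI[of _ _ _ nat]) auto
  hence "(f has_sum a) {0..}"
    using assms(1) by (subst (asm) has_sum_reindex_bij_betw)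
  moreover have "bij_betw (\<lambda>k. - 1 - int k) UNIV {..<0}"
    by (rule bij_betwI[of _ _ _ "\<lambda>n. nat (- 1 - n)"]) auto
  hence "(f has_sum b) {..<0}"
    using assms(2) by (subst (asm) has_sum_reindex_bij_betw)
  ultimately have "(f has_sum (a + b)) ({0..} \<union> {..<0})"
    by (rule has_sum_Un_disjoint) auto
  also have "{0..} \<union> {..<0} = (UNIV :: int set)" by auto
  finally show ?thesis .
qed

text \<open>
  The polygamma series starts out as a limit of consecutive partial sums; absolute convergence,
  read off from the real polygamma series, turns it into an unordered sum. This fails
  for $m = 0$, where the terms are of order $1/k$.
\<close>

lemma has_sum_half_integer_powers:
  assumes "m \<ge> 1"
  shows "((\<lambda>k. inverse ((1/2 + of_nat k :: complex) ^ Suc m)) has_sum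
           ((-1) ^ Suc m * Polygamma m (1/2) / fact m)) UNIV"
proof (rule norm_summable_imp_has_sum)
  have "norm (inverse ((1/2 + of_nat k :: complex) ^ Suc m)) = inverse ((1/2 + of_nat k :: real) ^ Suc m)" for k
  proof -
    have "1/2 + of_nat k = (of_real (1/2 + of_nat k) :: complex)" by simp
    thus ?thesis by (simp only: norm_inverse norm_power norm_of_real)
  qed
  thus "summable (\<lambda>k. norm (inverse ((1/2 + of_nat k :: complex) ^ Suc m)))"
    using Polygamma_converges'[of "1/2 :: real" "Suc m"] assms by simp
  show "(\<lambda>k. inverse ((1/2 + of_nat k :: complex) ^ Suc m)) sums
          ((-1) ^ Suc m * Polygamma m (1/2) / fact m)"
    using assms by (intro Polygamma_LIMSEQ) auto
qed

theorem corollary4: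
  fixes m :: nat
  assumes "m \<ge> 1"
  shows "(\<lambda>n::int. 1 / ((2 * of_int n + 1) * of_real pi * \<i>) ^ (m + 1)) summable_on UNIV
       \<and> euler_num m = 2 * fact m * (\<Sum>\<^sub>\<infinity>n::int. 1 / ((2 * of_int n + 1) * of_real pi * \<i>) ^ (m + 1))"
proof -
  define f :: "int \<Rightarrow> complex"
    where "f = (\<lambda>n. 1 / ((2 * of_int n + 1) * of_real pi * \<i>) ^ (m + 1))"
  define c :: complex where "c = 1 / (2 * of_real pi * \<i>) ^ Suc m"
  define S :: complex where "S = (-1) ^ Suc m * Polygamma m (1/2) / fact m"
  have *: "f (int k) = c * inverse ((1/2 + of_nat k) ^ Suc m)" for k
  proof -
    have "(2 * of_int (int k) + 1) * of_real pi * \<i> =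
            (2 * of_real pi * \<i>) * (1/2 + of_nat k :: complex)"
      by (simp add: algebra_simps)
    thus ?thesis
      unfolding f_def c_def Suc_eq_plus1 by (simp only: power_mult_distrib) (simp add: divide_simps)
  qed
  \<comment> \<open>The involution \<open>n \<mapsto> -1 - n\<close> negates the odd number \<open>2 * n + 1\<close>.\<close>
  have neg: "f (- 1 - n) = (-1) ^ Suc m * f n" for n
  proof -
    have "(2 * of_int (- 1 - n) + 1) * of_real pi * \<i> =
            (-1) * ((2 * of_int n + 1) * of_real pi * \<i> :: complex)"
      by (simp add: algebra_simps)
    thus ?thesis
      unfolding f_def Suc_eq_plus1 by (simp only: power_mult_distrib)
       (cases "even m"; simp)
  qed
  have "((\<lambda>k. f (int k)) has_sum (c * S)) UNIV"
    unfolding * S_def by (intro has_sum_cmult_right has_sum_half_integer_powers assms)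
  moreover from this have "((\<lambda>k. f (- 1 - int k)) has_sum ((-1) ^ Suc m * (c * S))) UNIV"
    unfolding neg by (rule has_sum_cmult_right)
  ultimately have sum: "(f has_sum (c * S + (-1) ^ Suc m * (c * S))) UNIV"
    by (rule has_sum_int_split)
  have "euler_num m = 2 * fact m * (c * S + (-1) ^ Suc m * (c * S))"
    unfolding euler_num_eq_Polygamma[OF assms] c_def S_def
    by (cases "even m") (simp_all add: field_simps)
  hence "f summable_on UNIV \<and> euler_num m = 2 * fact m * infsum f UNIV"
    using sum has_sum_imp_summable infsumI by metis
  thus ?thesis
    unfolding f_def .
qed

end
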